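(* Let $r \ge 2$ be an integer. Then for all integers $k\ge1$ and $n\ge rk$ and every partition $\mathcal{P} = \{P_1, \dots, P_\ell\}$ of $[n]$ with $|P_i| \le b(r)$ for all $i \in [\ell]$, we have $$\chi(\mathrm{KG}^r(n, k; \mathcal{P})) = \left\lceil \frac{n-r(k-1)}{r-1} \right\rceil.$$
   Context: For an integer $r\ge2$ with prime factorization $r=2^{\alpha_0}p_1^{\alpha_1}\cdots p_t^{\alpha_t}$ ($p_i$ pairwise distinct odd primes, $\alpha_i\ge0$), $b(r)=2^{\alpha_0}(p_1-1)^{\alpha_1}\cdots(p_t-1)^{\alpha_t}$. For a hypergraph $H$ (a set of hyperedges, each a multisubset of the vertex set), an $m$-coloring is a map from the vertices to $[m]$ such that no hyperedge is monochromatic; $\chi(H)$ is the least such $m$. For a partition $\mathcal{P}=\{P_1,\dots,P_\ell\}$ of $[n]$, $\mathrm{KG}^r(n,k;\mathcal{P})$ is the $r$-uniform hypergraph whose vertices are the $k$-element subsets $\sigma\subseteq[n]$ with $|\sigma\cap P_i|\le 1$ for all $i$, and whose hyperedges are the collections of $r$ such sets that are pairwise disjoint. *)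

theory Defs
  imports Complex_Main
    "HOL-Library.Multiset"
    "HOL-Library.FuncSet"
    "HOL-Library.Disjoint_Sets"
    "HOL-Computational_Algebra.Primes"
begin

definition kneser_b :: "nat \<Rightarrow> nat" where
  "kneser_b r = (\<Prod>p\<in>prime_factors r. (if p = 2 then 2 else p - 1) ^ multiplicity p r)"

record 'v hypergraph =
  vertices :: "'v set"
  hyperedges :: "'v multiset set"

definition monochromatic :: "('v \<Rightarrow> nat) \<Rightarrow> 'v multiset \<Rightarrow> bool" where
  "monochromatic c e \<longleftrightarrow> (\<exists>i. \<forall>v\<in>#e. c v = i)"

definition hg_coloring :: "'v hypergraph \<Rightarrow> nat \<Rightarrow> ('v \<Rightarrow> nat) \<Rightarrow> bool" where
  "hg_coloring H m c \<longleftrightarrow>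
     c \<in> vertices H \<rightarrow> {1..m} \<and> (\<forall>e\<in>hyperedges H. \<not> monochromatic c e)"

definition chromatic_number :: "'v hypergraph \<Rightarrow> nat" where
  "chromatic_number H = (LEAST m. \<exists>c. hg_coloring H m c)"

definition KG_vertices :: "nat \<Rightarrow> nat \<Rightarrow> nat set set \<Rightarrow> nat set set" where
  "KG_vertices n k P = {\<sigma>. \<sigma> \<subseteq> {1..n} \<and> card \<sigma> = k \<and> (\<forall>B\<in>P. card (\<sigma> \<inter> B) \<le> 1)}"

text \<open>For \<open>k \<ge> 1\<close> pairwise disjoint vertices are distinct, so every hyperedge is
  the multiset of a set of \<open>r\<close> vertices.\<close>

definition KG :: "nat \<Rightarrow> nat \<Rightarrow> nat \<Rightarrow> nat set set \<Rightarrow> nat set hypergraph" where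
  "KG r n k P =
     \<lparr> vertices = KG_vertices n k P,
       hyperedges = {mset_set F |F. F \<subseteq> KG_vertices n k P \<and> card F = r \<and> disjoint F} \<rparr>"

lemma finite_KG_vertices: "finite (KG_vertices n k P)"
  by (rule finite_subset[of _ "Pow {1..n}"]) (auto simp: KG_vertices_def)

lemma KG_hyperedge:
  assumes "e \<in> hyperedges (KG r n k P)"
  shows "set_mset e \<subseteq> vertices (KG r n k P)" and "size e = r"
proof -
  obtain F where F: "e = mset_set F" "F \<subseteq> KG_vertices n k P" "card F = r"
    using assms by (auto simp: KG_def)
  have "finite F" using F finite_KG_vertices finite_subset by blast
  then show "set_mset e \<subseteq> vertices (KG r n k P)" and "size e = r"
    using F by (auto simp: KG_def)
qed

text \<open>The minimum defining the chromatic number of \<open>KG r n k P\<close> is attained.\<close>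

lemma KG_colorable:
  assumes "r \<ge> 2"
  shows "\<exists>c. hg_coloring (KG r n k P) (chromatic_number (KG r n k P)) c"
proof -
  let ?V = "KG_vertices n k P"
  obtain h where h: "bij_betw h ?V {1..card ?V}"
    using finite_same_card_bij[OF finite_KG_vertices, of "{1..card ?V}" n k P] by auto
  have "\<not> monochromatic h (mset_set F)" if F: "F \<subseteq> ?V" "card F = r" for F
  proof
    assume "monochromatic h (mset_set F)"
    moreover have "finite F" using F finite_KG_vertices finite_subset by blast
    ultimately obtain i where i: "\<forall>v\<in>F. h v = i" by (auto simp: monochromatic_def)
    have "card (h ` F) = card F"
      using h F by (meson bij_betw_def card_image inj_on_subset)
    moreover have "card (h ` F) \<le> card {i}" using i by (intro card_mono) auto
    ultimately show False using F assms by simp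
  qed
  then have "hg_coloring (KG r n k P) (card ?V) h"
    using h by (auto simp: hg_coloring_def KG_def bij_betw_def)
  then show ?thesis
    unfolding chromatic_number_def
    by (intro LeastI_ex[where P = "\<lambda>m. \<exists>c. hg_coloring (KG r n k P) m c"]) blast
qed

end

theory Submission
  imports Defs "HOL-Number_Theory.Cong" "HOL-Library.Nat_Bijection"
begin

text \<open>
  The upper bound is Kneser's colouring by the minimum. For the lower bound blocks of size at most
  \<open>r\<close> suffice, and this version is multiplicative in \<open>r\<close>, so let \<open>r = p\<close> be prime and let \<open>c\<close> be a
  colouring with \<open>m\<close> colours.

  To a nonzero sign vector \<open>X\<close> on \<open>n\<close> elements with signs in \<open>\<int>/p\<close> attach the rank \<open>\<nu>(X)\<close>, the sum
  over the blocks of the number of distinct signs, as long as it is at most \<open>p(k - 1)\<close>; beyond that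
  some sign class contains a vertex, and the rank is \<open>p(k - 1)\<close> plus the sum over the colours \<open>i\<close> of
  the size of the set \<open>G\<^sub>i\<close> of signs whose class contains a vertex of colour \<open>i\<close>. No \<open>G\<^sub>i\<close> is all
  of \<open>\<int>/p\<close>, so ranks are at most \<open>p(k - 1) + m(p - 1)\<close>. Proper nonempty subsets of \<open>\<int>/p\<close> admit an
  equivariant choice of a point, and a block of size at most \<open>p\<close> that shows all \<open>p\<close> signs is
  completely filled; hence there is an equivariant label in \<open>\<int>/p\<close> that can only change along
  \<open>Y \<subseteq> X\<close> when the rank grows.

  On the other hand, every equivariant labelling admits a flag of \<open>n\<close> sign vectors in which
  consecutive labels differ (a \<open>\<int>/r\<close>-version of Fan's lemma), so \<open>n \<le> p(k - 1) + m(p - 1)\<close>. That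
  lemma is Dold's theorem in cochain form: a cochain supported on sequences with distinct
  neighbours is pulled back along the labelling and evaluated on the cycles of the periodic
  resolution, which gives \<open>1\<close> modulo \<open>r\<close>.
\<close>

section \<open>A Fan lemma for cyclic groups\<close>

text \<open>Simplices are vertex lists, cochains are functions on lists.\<close>

primrec coboundary :: "('v list \<Rightarrow> int) \<Rightarrow> 'v list \<Rightarrow> int" where
  "coboundary w [] = 0"
| "coboundary w (x # xs) = w xs - coboundary (\<lambda>ys. w (x # ys)) xs"

lemma coboundary_diff: "coboundary (\<lambda>y. w y - w' y) x = coboundary w x - coboundary w' x"
  by (induction x arbitrary: w w') auto

lemma coboundary_mult: "coboundary (\<lambda>y. c * w y) x = c * coboundary w x"
  by (induction x arbitrary: w) (auto simp: algebra_simps)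

lemma coboundary_zero [simp]: "coboundary (\<lambda>y. 0) x = 0"
  by (induction x) auto

lemma coboundary_sum: "coboundary (\<lambda>y. \<Sum>i\<in>I. w i y) x = (\<Sum>i\<in>I. coboundary (w i) x)"
  by (induction x arbitrary: w) (auto simp: sum_subtractf)

lemma coboundary_coboundary [simp]: "coboundary (coboundary w) x = 0"
  by (induction x arbitrary: w) (auto simp: coboundary_diff)

lemma coboundary_map: "coboundary w (map h x) = coboundary (\<lambda>y. w (map h y)) x"
  by (induction x arbitrary: w) auto

lemma coboundary_cong:
  assumes "\<And>us v ws. x = us @ v # ws \<Longrightarrow> w (us @ ws) = w' (us @ ws)"
  shows "coboundary w x = coboundary w' x"
  using assms
proof (induction x arbitrary: w w')
  case (Cons a x)
  have "w x = w' x" using Cons.prems[of "[]" a x] by simp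
  moreover have "coboundary (\<lambda>ys. w (a # ys)) x = coboundary (\<lambda>ys. w' (a # ys)) x"
    by (rule Cons.IH) (use Cons.prems[of "a # _"] in simp)
  ultimately show ?case by simp
qed simp

lemma coboundary_nonzero:
  assumes "coboundary w x \<noteq> 0"
  obtains us v ws where "x = us @ v # ws" "w (us @ ws) \<noteq> 0"
  using coboundary_cong[of x w "\<lambda>_. 0"] assms by auto

text \<open>Pulls a cochain \<open>f\<close> on label sequences back along the barycentric subdivision: the value at
  \<open>x\<close> is the signed sum of \<open>f\<close> over the labels of all maximal flags \<open>x = y\<^sub>k \<supset> \<dots> \<supset> y\<^sub>1\<close>, largest
  face first.\<close>

primrec subdiv :: "('v list \<Rightarrow> 'l) \<Rightarrow> nat \<Rightarrow> ('l list \<Rightarrow> int) \<Rightarrow> 'v list \<Rightarrow> int" where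
  "subdiv l 0 f x = f []"
| "subdiv l (Suc k) f x = coboundary (\<lambda>y. subdiv l k (\<lambda>as. f (l x # as)) y) x"

lemma subdiv_diff: "subdiv l k (\<lambda>as. f as - f' as) x = subdiv l k f x - subdiv l k f' x"
  by (induction k arbitrary: f f' x) (auto simp: coboundary_diff)

lemma subdiv_sum: "subdiv l k (\<lambda>as. \<Sum>i\<in>I. f i as) x = (\<Sum>i\<in>I. subdiv l k (f i) x)"
  by (induction k arbitrary: f x) (auto simp: coboundary_sum)

text \<open>Splitting off the leading label turns \<open>coboundary f\<close> into \<open>f\<close>
  minus a coboundary in the remaining labels. By induction the second part contributes a double
  coboundary, which vanishes.\<close>

lemma subdiv_coboundary: "subdiv l (Suc k) (coboundary f) x = coboundary (subdiv l k f) x"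
proof (induction k arbitrary: f x)
  case 0
  then show ?case by simp
next
  case (Suc k)
  have "subdiv l (Suc (Suc k)) (coboundary f) x =
      coboundary (\<lambda>y. subdiv l (Suc k) (\<lambda>as. f as - coboundary (\<lambda>bs. f (l x # bs)) as) y) x"
    by (subst subdiv.simps(2)) (simp only: coboundary.simps)
  also have "\<dots> = coboundary (subdiv l (Suc k) f) x
      - coboundary (coboundary (subdiv l k (\<lambda>bs. f (l x # bs)))) x"
    by (simp only: subdiv_diff Suc.IH coboundary_diff)
  also have "\<dots> = coboundary (subdiv l (Suc k) f) x" by (simp only: coboundary_coboundary diff_0_right)
  finally show ?case .
qed

text \<open>A nonzero signed sum over flags has a nonzero summand. \<open>Q\<close> stands for a
  property inherited by faces; it will be \<open>sign_vector\<close>.\<close>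

lemma subdiv_nonzero:
  assumes "subdiv l k f x \<noteq> 0" "length x = k" "Q x"
    and "\<And>us v ws. Q (us @ v # ws) \<Longrightarrow> Q (us @ ws)"
  shows "\<exists>ys. length ys = k \<and> f (map l ys) \<noteq> 0 \<and> (\<forall>y\<in>set ys. y \<noteq> [] \<and> Q y) \<and>
    (k > 0 \<longrightarrow> hd ys = x) \<and> successively (\<lambda>y z. set z \<subseteq> set y) ys"
  using assms
proof (induction k arbitrary: f x)
  case (Suc k)
  obtain us v ws where x: "x = us @ v # ws"
    and nz: "subdiv l k (\<lambda>as. f (l x # as)) (us @ ws) \<noteq> 0"
    using Suc.prems(1) by (auto elim: coboundary_nonzero)
  have "Q (us @ ws)" using Suc.prems x by blast
  from Suc.IH[OF nz _ this] x Suc.prems obtain ys where ys: "length ys = k"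
    "f (l x # map l ys) \<noteq> 0" "\<forall>y\<in>set ys. y \<noteq> [] \<and> Q y" "k > 0 \<longrightarrow> hd ys = us @ ws"
    "successively (\<lambda>y z. set z \<subseteq> set y) ys" by auto
  show ?case
    by (rule exI[of _ "x # ys"]) (use ys x Suc.prems in \<open>auto simp: successively_Cons\<close>)
qed simp

section \<open>Alternating cochains on a cyclic group\<close>

text \<open>The carry of adding the cyclic distances \<open>b - a\<close> and \<open>c - b\<close>, that is, the 2-cocycle
  of the periodic resolution of a cyclic group. Cup powers of it times a cochain of degree 0 or 1
  give \<open>alt_cochain\<close>, which vanishes on sequences with two equal neighbours.\<close>

definition carry :: "nat \<Rightarrow> nat \<Rightarrow> nat \<Rightarrow> int" where
  "carry a b c = of_bool (b > c) - of_bool (a > c) + of_bool (a > b)"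

fun alt_cochain :: "nat \<Rightarrow> nat list \<Rightarrow> int" where
  "alt_cochain r [] = 0"
| "alt_cochain r [a] = of_bool (Suc a = r)"
| "alt_cochain r [a, b] = of_bool (a > b)"
| "alt_cochain r (a # b # c # as) = carry a b c * alt_cochain r (c # as)"

definition rot :: "nat \<Rightarrow> nat \<Rightarrow> nat \<Rightarrow> nat" where
  "rot r g a = (a + g) mod r"

lemma rot_rot: "rot r g (rot r h a) = rot r (h + g) a"
  by (simp add: rot_def mod_add_left_eq add.assoc)

lemma rot_less: "r > 0 \<Longrightarrow> rot r g a < r"
  by (simp add: rot_def)

lemma rot_0: "a < r \<Longrightarrow> rot r 0 a = a"
  by (simp add: rot_def)

lemma rot_r: "rot r r a = rot r 0 a"
  by (simp add: rot_def)

lemma rot_1: "a < r \<Longrightarrow> rot r (Suc 0) a = (if Suc a = r then 0 else Suc a)"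
  by (simp add: rot_def)

lemma carry_rot1:
  assumes "a < r" "b < r" "c < r"
  shows "carry (rot r 1 a) (rot r 1 b) (rot r 1 c) = carry a b c"
  using assms by (auto simp: carry_def rot_1)

lemma carry_rot:
  assumes "a < r" "b < r" "c < r"
  shows "carry (rot r g a) (rot r g b) (rot r g c) = carry a b c"
proof (induction g)
  case 0
  then show ?case using assms by (simp add: rot_0)
next
  case (Suc g)
  have "r > 0" using assms by simp
  have "rot r (Suc g) x = rot r 1 (rot r g x)" for x by (simp add: rot_rot)
  then show ?case using Suc carry_rot1 rot_less[OF \<open>r > 0\<close>] by simp
qed

text \<open>Leibniz rule: \<open>carry\<close> is a cocycle, so only the coboundary of the other
  factor survives. This shortens lists by two and leaves lengths two and three as base cases
  below.\<close>

lemma coboundary_alt_cochain: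
  "coboundary (alt_cochain r) (a # b # c # d # as) = carry a b c * coboundary (alt_cochain r) (c # d # as)"
proof -
  have cocycle: "carry b c d - carry a c d + carry a b d = carry a b c" by (simp add: carry_def)
  have "coboundary (alt_cochain r) (a # b # c # d # as) = (carry b c d - carry a c d + carry a b d) * alt_cochain r (d # as)
      - carry a b c * coboundary (\<lambda>ys. alt_cochain r (c # ys)) (d # as)"
    by (simp add: coboundary_mult algebra_simps)
  also have "\<dots> = carry a b c * coboundary (alt_cochain r) (c # d # as)"
    by (simp only: cocycle coboundary.simps(2)[of _ c] right_diff_distrib)
  finally show ?thesis .
qed

text \<open>This and \<open>alt_cochain_odd\<close> make \<open>alt_cochain\<close> compatible with
  the two alternating maps of the periodic resolution. For two labels, only the wraparound from
  \<open>r - 1\<close> to 0 can change their order; longer lists reduce to this by the invariance of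
  \<open>carry\<close>.\<close>

lemma alt_cochain_even:
  assumes "even (length as)" "as \<noteq> []" "set as \<subseteq> {..<r}"
  shows "alt_cochain r (map (rot r 1) as) - alt_cochain r as = coboundary (alt_cochain r) as"
  using assms
proof (induction as rule: induct_list012)
  case (3 a b as)
  show ?case
  proof (cases as)
    case Nil
    then show ?thesis using 3 by (auto simp: rot_1)
  next
    case (Cons c bs)
    then obtain d cs where as: "as = c # d # cs" using 3 by (cases bs) auto
    show ?thesis using 3 carry_rot1[of a r b c] by (simp add: as coboundary_alt_cochain flip: right_diff_distrib del: coboundary.simps)
  qed
qed auto

lemma alt_cochain_single:
  assumes "a < r"
  shows "(\<Sum>g<r. alt_cochain r [rot r g a]) = 1"
proof -
  have "(\<Sum>g<r. alt_cochain r [rot r g a]) = (\<Sum>g<r. if g = r - 1 - a then 1 else 0)"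
  proof (rule sum.cong)
    fix g assume g: "g \<in> {..<r}"
    show "alt_cochain r [rot r g a] = (if g = r - 1 - a then 1 else 0)"
    proof (cases "a + g < r")
      case False
      then have "(a + g) mod r = a + g - r" using g assms by (simp add: mod_if)
      then show ?thesis using g assms False by (auto simp: rot_def)
    qed (auto simp: rot_def)
  qed simp
  also have "\<dots> = 1" using assms by simp
  finally show ?thesis .
qed

text \<open>For three labels the invariant factor \<open>carry\<close> comes out of the sum and the
  rest sums to 1, while \<open>carry\<close> itself is the coboundary of the two-label
  cochain.\<close>

lemma alt_cochain_odd:
  assumes "odd (length as)" "length as > 1" "set as \<subseteq> {..<r}"
  shows "(\<Sum>g<r. alt_cochain r (map (rot r g) as)) = coboundary (alt_cochain r) as"
  using assms
proof (induction as rule: induct_list012)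
  case (3 a b as)
  then obtain c bs where as: "as = c # bs" by (cases as) auto
  show ?case
  proof (cases bs)
    case Nil
    then show ?thesis using 3 as alt_cochain_single[of c r]
      by (simp add: carry_rot flip: sum_distrib_left) (simp add: carry_def)
  next
    case (Cons d cs)
    show ?thesis using 3 Cons by (simp add: as carry_rot coboundary_alt_cochain flip: sum_distrib_left del: coboundary.simps)
  qed
qed auto

lemma alt_cochain_nonzero: "alt_cochain r as \<noteq> 0 \<Longrightarrow> distinct_adj as"
  by (induction r as rule: alt_cochain.induct) (auto simp: carry_def)


section \<open>The periodic resolution and its cycles\<close>

definition shift :: "nat \<Rightarrow> nat \<Rightarrow> ('a \<times> nat) list \<Rightarrow> ('a \<times> nat) list" where
  "shift r g = map (apsnd (rot r g))"

lemma shift_shift: "shift r g (shift r h x) = shift r (h + g) x"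
  by (auto simp: shift_def rot_rot)

lemma shift_r: "shift r r x = shift r 0 x"
  by (simp add: shift_def rot_r apsnd_def map_prod_def)

lemma length_shift [simp]: "length (shift r g x) = length x"
  by (simp add: shift_def)

lemma coboundary_shift: "coboundary w (shift r g x) = coboundary (\<lambda>y. w (shift r g y)) x"
  by (simp add: shift_def coboundary_map)

text \<open>The maps \<open>t - 1\<close> and \<open>1 + t + \<dots> + t\<^sup>r\<^sup>-\<^sup>1\<close> of the periodic resolution, in alternation.
  Using \<open>shift r 0\<close> (reduction mod \<open>r\<close>) rather than the identity makes \<open>resolution_resolution\<close>
  hold without range conditions on the signs.\<close>

definition resolution :: "nat \<Rightarrow> nat \<Rightarrow> (('a \<times> nat) list \<Rightarrow> int) \<Rightarrow> ('a \<times> nat) list \<Rightarrow> int" where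
  "resolution r k w x = (if k = 0 then w x
     else if odd k then w (shift r 1 x) - w (shift r 0 x)
     else (\<Sum>g<r. w (shift r g x)))"

lemma resolution_diff: "resolution r k (\<lambda>x. w x - w' x) = (\<lambda>x. resolution r k w x - resolution r k w' x)"
  by (auto simp: resolution_def sum_subtractf)

lemma resolution_coboundary: "resolution r k (coboundary w) = coboundary (resolution r k w)"
  unfolding resolution_def[abs_def] by (auto simp: coboundary_shift coboundary_diff coboundary_sum)

lemma resolution_resolution: "resolution r (Suc k) (resolution r (Suc (Suc k)) w) = (\<lambda>x. 0)"
proof -
  have tel: "(\<Sum>g<r. w (shift r (Suc g) x)) = (\<Sum>g<r. w (shift r g x))" for x
  proof -
    have "(\<Sum>g<r. w (shift r (Suc g) x) - w (shift r g x)) = w (shift r r x) - w (shift r 0 x)"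
      by (rule sum_lessThan_telescope)
    then show ?thesis by (simp add: shift_r sum_subtractf)
  qed
  then show ?thesis by (auto simp: resolution_def shift_shift fun_eq_iff sum_subtractf)
qed

text \<open>Evaluation of a cochain on the chain \<open>e\<^sub>k\<close> with \<open>e\<^sub>k\<^sub>+\<^sub>1\<close> the cone with apex \<open>(e k, 0)\<close> over the
  image of \<open>e\<^sub>k\<close> under the resolution map, so that the boundary of \<open>e\<^sub>k\<^sub>+\<^sub>1\<close> is that image.\<close>

primrec eval_cycle :: "nat \<Rightarrow> (nat \<Rightarrow> 'a) \<Rightarrow> nat \<Rightarrow> (('a \<times> nat) list \<Rightarrow> int) \<Rightarrow> int" where
  "eval_cycle r e 0 u = u []"
| "eval_cycle r e (Suc k) u = eval_cycle r e k (resolution r k (\<lambda>x. u ((e k, 0) # x)))"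

lemma eval_cycle_diff:
  "eval_cycle r e k (\<lambda>x. u x - w x) = eval_cycle r e k u - eval_cycle r e k w"
  by (induction k arbitrary: u w) (auto simp: resolution_diff)

lemma eval_cycle_zero [simp]: "eval_cycle r e k (\<lambda>x. 0) = 0"
  using eval_cycle_diff[of r e k "\<lambda>x. 0" "\<lambda>x. 0"] by simp

lemma eval_cycle_add:
  "eval_cycle r e k (\<lambda>x. u x + w x) = eval_cycle r e k u + eval_cycle r e k w"
  using eval_cycle_diff[of r e k "\<lambda>x. u x + w x" w] by simp

lemma eval_cycle_sum:
  "eval_cycle r e k (\<lambda>x. \<Sum>i\<in>I. u i x) = (\<Sum>i\<in>I. eval_cycle r e k (u i))"
  by (induction I rule: infinite_finite_induct) (auto simp: eval_cycle_add)

text \<open>Stokes' theorem for the cones. The boundary of a cone is its base minus the cone over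
  the boundary of the base, and the base is a cycle because consecutive resolution maps compose to
  zero.\<close>

lemma eval_cycle_coboundary:
  "eval_cycle r e (Suc k) (coboundary w) = eval_cycle r e k (resolution r k w)"
proof (induction k arbitrary: w)
  case 0
  then show ?case by (simp add: resolution_def)
next
  case (Suc k)
  let ?w = "resolution r (Suc k) (\<lambda>x. w ((e (Suc k), 0) # x))"
  have z: "eval_cycle r e (Suc k) (coboundary ?w) = 0"
  proof (cases k)
    case 0
    \<comment> \<open>In the lowest degree the cochain is evaluated on the empty list, which every
      shift fixes.\<close>
    then show ?thesis unfolding Suc.IH by (simp add: resolution_def shift_def)
  next
    case (Suc j)
    then show ?thesis unfolding Suc.IH by (simp add: resolution_resolution)
  qed
  have "eval_cycle r e (Suc (Suc k)) (coboundary w) =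
      eval_cycle r e (Suc k) (resolution r (Suc k) (\<lambda>x. w x - coboundary (\<lambda>y. w ((e (Suc k), 0) # y)) x))"
    by (subst eval_cycle.simps(2)) (simp only: coboundary.simps)
  also have "\<dots> = eval_cycle r e (Suc k) (resolution r (Suc k) w) - eval_cycle r e (Suc k) (coboundary ?w)"
    by (simp only: resolution_diff eval_cycle_diff resolution_coboundary)
  finally show ?case using z by simp
qed

definition sign_vector :: "nat \<Rightarrow> 'a set \<Rightarrow> ('a \<times> nat) list \<Rightarrow> bool" where
  "sign_vector r A x \<longleftrightarrow> distinct (map fst x) \<and> set x \<subseteq> A \<times> {..<r}"

lemma sign_vector_shift: "r > 0 \<Longrightarrow> sign_vector r A x \<Longrightarrow> sign_vector r A (shift r g x)"
  by (auto simp: sign_vector_def shift_def rot_less)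

lemma sign_vector_delete: "sign_vector r A (us @ v # ws) \<Longrightarrow> sign_vector r A (us @ ws)"
  by (auto simp: sign_vector_def)

lemma shift_0: "sign_vector r A x \<Longrightarrow> shift r 0 x = x"
  unfolding shift_def sign_vector_def by (intro map_idI) (auto simp: rot_0)

text \<open>The chain behind \<open>eval_cycle\<close> is supported on sign vectors over the first
  \<open>k\<close> points of \<open>e\<close>; the relations for pulled-back cochains are available
  only there.\<close>

lemma eval_cycle_cong:
  assumes "r > 0" "inj_on e {..<k}"
    and "\<And>x. length x = k \<Longrightarrow> sign_vector r (e ` {..<k}) x \<Longrightarrow> u x = w x"
  shows "eval_cycle r e k u = eval_cycle r e k w"
  using assms
proof (induction k arbitrary: u w)
  case (Suc k)
  have *: "u ((e k, 0) # shift r g x) = w ((e k, 0) # shift r g x)"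
    if "length x = k" "sign_vector r (e ` {..<k}) x" for x g
  proof (rule Suc.prems(3))
    have s: "sign_vector r (e ` {..<k}) (shift r g x)" using that Suc.prems(1) sign_vector_shift by blast
    moreover have "e k \<notin> e ` {..<k}" using Suc.prems(2) by (simp add: lessThan_Suc)
    ultimately show "sign_vector r (e ` {..<Suc k}) ((e k, 0) # shift r g x)"
      using Suc.prems(1) by (fastforce simp: sign_vector_def)
  qed (use that in simp)
  have "resolution r k (\<lambda>x. u ((e k, 0) # x)) x = resolution r k (\<lambda>x. w ((e k, 0) # x)) x"
    if "length x = k" "sign_vector r (e ` {..<k}) x" for x
    using *[OF that] *[OF that, of 0] shift_0[OF that(2)] unfolding resolution_def by (cases "k = 0") simp_all
  then show ?case
    by (simp, intro Suc.IH) (use Suc.prems in \<open>auto simp: inj_on_def\<close>)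
qed (simp add: sign_vector_def)

section \<open>Equivariant labellings and alternating flags\<close>

locale equivariant_labelling =
  fixes r :: nat and A :: "'a set" and l :: "('a \<times> nat) list \<Rightarrow> nat"
  assumes r: "r \<ge> 2"
    and l_less: "\<And>x. sign_vector r A x \<Longrightarrow> x \<noteq> [] \<Longrightarrow> l x < r"
    and l_shift: "\<And>x g. sign_vector r A x \<Longrightarrow> x \<noteq> [] \<Longrightarrow> l (shift r g x) = rot r g (l x)"
begin

lemma subdiv_shift:
  assumes "sign_vector r A x" "length x = k"
  shows "subdiv l k f (shift r g x) = subdiv l k (\<lambda>as. f (map (rot r g) as)) x"
  using assms
proof (induction k arbitrary: f x)
  case (Suc k)
  have "x \<noteq> []" using Suc.prems by auto
  then have "l (shift r g x) = rot r g (l x)" using Suc.prems l_shift by blast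
  then show ?case
    by (simp only: subdiv.simps coboundary_shift list.map, intro coboundary_cong Suc.IH)
      (use Suc.prems sign_vector_delete in auto)
qed simp

lemma subdiv_cong:
  assumes "sign_vector r A x" "length x = k"
    and "\<And>as. length as = k \<Longrightarrow> set as \<subseteq> {..<r} \<Longrightarrow> f as = f' as"
  shows "subdiv l k f x = subdiv l k f' x"
  using assms
proof (induction k arbitrary: f f' x)
  case (Suc k)
  have "x \<noteq> []" using Suc.prems by auto
  then have "l x < r" using Suc.prems l_less by blast
  then show ?case
    by (simp only: subdiv.simps, intro coboundary_cong Suc.IH)
      (use Suc.prems sign_vector_delete in auto)
qed simp

abbreviation pullback where "pullback k \<equiv> subdiv l k (alt_cochain r)"

text \<open>Equivariance turns shifts of vertices into rotations of labels, and
  \<open>subdiv\<close> commutes with \<open>coboundary\<close>; so the relations of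
  \<open>alt_cochain\<close> carry over, here and in \<open>pullback_even\<close>.\<close>

lemma pullback_odd:
  assumes "sign_vector r A x" "length x = Suc k" "even k" "k > 0"
  shows "(\<Sum>g<r. pullback (Suc k) (shift r g x)) = coboundary (pullback k) x"
proof -
  have "(\<Sum>g<r. pullback (Suc k) (shift r g x)) = subdiv l (Suc k) (\<lambda>as. \<Sum>g<r. alt_cochain r (map (rot r g) as)) x"
    using assms by (simp only: subdiv_shift subdiv_sum)
  also have "\<dots> = subdiv l (Suc k) (coboundary (alt_cochain r)) x"
    using assms by (intro subdiv_cong alt_cochain_odd) auto
  finally show ?thesis by (simp only: subdiv_coboundary)
qed

lemma pullback_even:
  assumes "sign_vector r A x" "length x = Suc k" "odd k"
  shows "pullback (Suc k) (shift r 1 x) - pullback (Suc k) x = coboundary (pullback k) x"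
proof -
  have "pullback (Suc k) (shift r 1 x) - pullback (Suc k) x =
      subdiv l (Suc k) (\<lambda>as. alt_cochain r (map (rot r 1) as) - alt_cochain r as) x"
    using assms by (simp only: subdiv_shift subdiv_diff)
  also have "\<dots> = subdiv l (Suc k) (coboundary (alt_cochain r)) x"
    using assms by (intro subdiv_cong alt_cochain_even) auto
  finally show ?thesis by (simp only: subdiv_coboundary)
qed

text \<open>A degree computation modulo \<open>r\<close>: the value is 1 on a single vertex, and
  Stokes passes it from each degree to the next.\<close>

lemma eval_cycle_pullback:
  assumes "k \<ge> 1" "inj_on e {..<k}" "e ` {..<k} \<subseteq> A"
  shows "int r dvd eval_cycle r e k (\<lambda>x. \<Sum>g<r. pullback k (shift r g x)) - 1"
  using assms
proof (induction k rule: dec_induct)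
  case base
  have sv: "sign_vector r A [(e 0, 0)]" using base r by (auto simp: sign_vector_def)
  have "(\<Sum>g<r. pullback 1 (shift r g [(e 0, 0)])) = (\<Sum>g<r. alt_cochain r [rot r g (l [(e 0, 0)])])"
    using sv l_shift[OF sv] by (simp add: shift_def)
  also have "\<dots> = 1" using alt_cochain_single l_less[OF sv] by simp
  finally show ?case by (simp add: resolution_def)
next
  case (step k)
  have sub: "sign_vector r A x" if "sign_vector r (e ` {..<Suc k}) x" for x
    using that step.prems by (auto simp: sign_vector_def)
  have r0: "r > 0" using r by simp
  have IH: "int r dvd eval_cycle r e k (\<lambda>x. \<Sum>g<r. pullback k (shift r g x)) - 1"
    by (rule step.IH) (use step.prems in \<open>auto simp: inj_on_def\<close>)
  show ?case
  proof (cases "even k")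
    case True
    have "eval_cycle r e (Suc k) (\<lambda>x. \<Sum>g<r. pullback (Suc k) (shift r g x)) =
        eval_cycle r e (Suc k) (coboundary (pullback k))"
      using True step sub r0 by (intro eval_cycle_cong pullback_odd) auto
    also have "\<dots> = eval_cycle r e k (\<lambda>x. \<Sum>g<r. pullback k (shift r g x))"
      using True step.hyps by (simp only: eval_cycle_coboundary) (simp add: resolution_def [abs_def])
    finally show ?thesis using IH by simp
  next
    case False
    \<comment> \<open>For odd \<open>k\<close> the relation concerns differences of consecutive
      shifts. Hence \<open>a j - b j\<close> does not depend on \<open>j\<close>, and the sums over
      all \<open>r\<close> shifts differ by a multiple of \<open>r\<close>.\<close>
    define a where "a j = eval_cycle r e (Suc k) (\<lambda>x. pullback (Suc k) (shift r j x))" for j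
    define b where "b j = eval_cycle r e k (\<lambda>x. pullback k (shift r j x))" for j
    have "a (Suc j) - a j = b (Suc j) - b j" for j
    proof -
      have "a (Suc j) - a j =
          eval_cycle r e (Suc k) (\<lambda>x. pullback (Suc k) (shift r (Suc j) x) - pullback (Suc k) (shift r j x))"
        unfolding a_def by (rule eval_cycle_diff[symmetric])
      also have "\<dots> = eval_cycle r e (Suc k) (coboundary (\<lambda>x. pullback k (shift r j x)))"
      proof (rule eval_cycle_cong)
        fix x assume x: "length x = Suc k" "sign_vector r (e ` {..<Suc k}) x"
        have "pullback (Suc k) (shift r 1 (shift r j x)) - pullback (Suc k) (shift r j x) =
            coboundary (pullback k) (shift r j x)"
          using x False sub[OF sign_vector_shift[OF r0 x(2)]] by (intro pullback_even) auto
        then show "pullback (Suc k) (shift r (Suc j) x) - pullback (Suc k) (shift r j x) =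
            coboundary (\<lambda>x. pullback k (shift r j x)) x"
          by (simp only: shift_shift coboundary_shift) simp
      qed (use r0 step.prems in auto)
      also have "\<dots> = eval_cycle r e k (\<lambda>x. pullback k (shift r (Suc j) x) - pullback k (shift r j x))"
        using False step.hyps
        by (simp only: eval_cycle_coboundary) (simp add: resolution_def [abs_def] shift_shift)
      also have "\<dots> = b (Suc j) - b j"
        unfolding b_def by (rule eval_cycle_diff)
      finally show ?thesis .
    qed
    then have ab: "a (Suc j) - b (Suc j) = a j - b j" for j
      by (simp add: algebra_simps)
    have "a j - b j = a 0 - b 0" for j
      by (induction j) (simp_all add: ab)
    then have "(\<Sum>j<r. a j - b j) = (\<Sum>j<r. a 0 - b 0)" by (intro sum.cong) auto
    then have "(\<Sum>j<r. a j) - (\<Sum>j<r. b j) = int r * (a 0 - b 0)"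
      by (simp add: sum_subtractf algebra_simps)
    moreover have "eval_cycle r e (Suc k) (\<lambda>x. \<Sum>g<r. pullback (Suc k) (shift r g x)) = (\<Sum>j<r. a j)"
      unfolding a_def by (rule eval_cycle_sum)
    moreover have "eval_cycle r e k (\<lambda>x. \<Sum>g<r. pullback k (shift r g x)) = (\<Sum>j<r. b j)"
      unfolding b_def by (rule eval_cycle_sum)
    ultimately show ?thesis using IH
      by (metis add_diff_eq diff_add_cancel dvd_add dvd_triv_left)
  qed
qed

text \<open>A value congruent to 1 modulo \<open>r >= 2\<close> is nonzero, so the pulled-back
  cochain is nonzero at some sign vector. Some flag below it then has labels on which
  \<open>alt_cochain\<close> is nonzero.\<close>

theorem alternating_chain:
  assumes "finite A" "A \<noteq> {}"
  obtains ys where "length ys = card A" "distinct_adj (map l ys)"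
    "\<forall>y\<in>set ys. y \<noteq> [] \<and> sign_vector r A y"
    "successively (\<lambda>y z. set z \<subseteq> set y) ys"
proof -
  obtain e where e: "bij_betw e {..<card A} A"
    using ex_bij_betw_nat_finite[OF assms(1)] by (auto simp: atLeast0LessThan)
  let ?n = "card A"
  have n: "?n \<ge> 1" using assms by (simp add: Suc_leI card_gt_0_iff)
  have *: "int r dvd eval_cycle r e ?n (\<lambda>x. \<Sum>g<r. pullback ?n (shift r g x)) - 1"
    using e n by (intro eval_cycle_pullback) (auto simp: bij_betw_def)
  have "\<exists>x. length x = ?n \<and> sign_vector r A x \<and> pullback ?n x \<noteq> 0"
  proof (rule ccontr)
    assume c: "\<not> ?thesis"
    have "eval_cycle r e ?n (\<lambda>x. \<Sum>g<r. pullback ?n (shift r g x)) = eval_cycle r e ?n (\<lambda>x. 0)"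
    proof (rule eval_cycle_cong)
      fix x assume x: "length x = ?n" "sign_vector r (e ` {..<?n}) x"
      then have "sign_vector r A x" using e by (simp add: bij_betw_def)
      then have "pullback ?n (shift r g x) = 0" for g
        using c x(1) sign_vector_shift[of r A x g] r by auto
      then show "(\<Sum>g<r. pullback ?n (shift r g x)) = 0" by simp
    qed (use r e in \<open>auto simp: bij_betw_def\<close>)
    then show False using * r by (simp add: zdvd_not_zless)
  qed
  then obtain x where x: "length x = ?n" "sign_vector r A x" "pullback ?n x \<noteq> 0" by blast
  from subdiv_nonzero[OF x(3,1), of "sign_vector r A", OF x(2)]
  show ?thesis using that alt_cochain_nonzero sign_vector_delete by blast
qed

text \<open>Along an alternating flag the rank drops at every step and stays at least 1, so the
  largest member has rank at least \<open>card A\<close>.\<close>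

lemma card_le_rank:
  assumes "finite A"
    and bounds: "\<And>x. sign_vector r A x \<Longrightarrow> x \<noteq> [] \<Longrightarrow> 1 \<le> \<rho> x \<and> \<rho> x \<le> M"
    and mono: "\<And>x y. sign_vector r A x \<Longrightarrow> sign_vector r A y \<Longrightarrow> y \<noteq> [] \<Longrightarrow> set y \<subseteq> set x \<Longrightarrow>
      \<rho> y < \<rho> x \<or> l y = l x"
  shows "card A \<le> M"
proof (cases "A = {}")
  case False
  then obtain ys where ys: "length ys = card A" "distinct_adj (map l ys)"
    "\<forall>y\<in>set ys. y \<noteq> [] \<and> sign_vector r A y" "successively (\<lambda>y z. set z \<subseteq> set y) ys"
    using alternating_chain assms(1) by blast
  have "length zs \<le> \<rho> (hd zs)"
    if "zs \<noteq> []" "distinct_adj (map l zs)" "\<forall>y\<in>set zs. y \<noteq> [] \<and> sign_vector r A y"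
      "successively (\<lambda>y z. set z \<subseteq> set y) zs" for zs
    using that
  proof (induction zs rule: induct_list012)
    case (2 x)
    then show ?case using bounds by simp
  next
    case (3 x y zs)
    then have "\<rho> y < \<rho> x" using mono[of x y] by auto
    then show ?case using 3 by auto
  qed simp
  moreover have "ys \<noteq> []" using ys(1) False assms(1) by auto
  ultimately show ?thesis using ys bounds by (metis hd_in_set le_trans)
qed simp

end

section \<open>Forcing monochromatic families\<close>

text \<open>A sign vector with signs mod \<open>r\<close> is encoded as a set of pairs \<open>(element, sign)\<close>.\<close>

definition signs_with :: "('a set \<Rightarrow> bool) \<Rightarrow> ('a \<times> nat) set \<Rightarrow> nat set" where
  "signs_with \<Phi> X = {g. \<Phi> {a. (a, g) \<in> X}}"

lemma inj_on_rot: "inj_on (rot r g) {..<r}"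
proof (rule inj_onI)
  fix a b assume "a \<in> {..<r}" "b \<in> {..<r}" "rot r g a = rot r g b"
  then show "a = b" unfolding rot_def
    by (metis cong_def cong_add_rcancel_nat lessThan_iff mod_less)
qed

text \<open>Signs are natural numbers; those from \<open>r\<close> on have an empty class, which the
  assumption on \<open>\<Phi>\<close> excludes.\<close>

lemma signs_with_subset: "X \<subseteq> A \<times> {..<r} \<Longrightarrow> \<not> \<Phi> {} \<Longrightarrow> signs_with \<Phi> X \<subseteq> {..<r}"
  unfolding signs_with_def by (auto, metis (no_types, lifting) Collect_empty_eq SigmaD2 lessThan_iff subsetD)

lemma signs_with_mono:
  assumes "Y \<subseteq> X" "mono \<Phi>"
  shows "signs_with \<Phi> Y \<subseteq> signs_with \<Phi> X"
proof
  fix g assume "g \<in> signs_with \<Phi> Y"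
  moreover have "{a. (a, g) \<in> Y} \<subseteq> {a. (a, g) \<in> X}" using assms by auto
  ultimately show "g \<in> signs_with \<Phi> X" using monoD[OF assms(2)] unfolding signs_with_def by auto
qed

lemma signs_with_shift:
  assumes "X \<subseteq> A \<times> {..<r}" "\<not> \<Phi> {}"
  shows "signs_with \<Phi> (apsnd (rot r g) ` X) = rot r g ` signs_with \<Phi> X"
proof -
  have cls: "{a. (a, rot r g h) \<in> apsnd (rot r g) ` X} = {a. (a, h) \<in> X}" if "h < r" for h
  proof (intro equalityI subsetI)
    fix a assume "a \<in> {a. (a, rot r g h) \<in> apsnd (rot r g) ` X}"
    then obtain h' where h': "(a, h') \<in> X" "rot r g h = rot r g h'" by auto
    then have "h' < r" using assms(1) by auto
    then have "h = h'" using h' that inj_onD[OF inj_on_rot[of r g], of h h'] by simp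
    then show "a \<in> {a. (a, h) \<in> X}" using h' by simp
  next
    fix a assume "a \<in> {a. (a, h) \<in> X}"
    then have "apsnd (rot r g) (a, h) \<in> apsnd (rot r g) ` X" by (intro imageI) simp
    then show "a \<in> {a. (a, rot r g h) \<in> apsnd (rot r g) ` X}" by simp
  qed
  show ?thesis
  proof (intro equalityI subsetI)
    fix h assume h: "h \<in> signs_with \<Phi> (apsnd (rot r g) ` X)"
    then have "{a. (a, h) \<in> apsnd (rot r g) ` X} \<noteq> {}"
      using assms(2) unfolding signs_with_def by (metis mem_Collect_eq)
    then obtain a h' where "(a, h') \<in> X" "h = rot r g h'" by auto
    with h cls[of h'] assms(1) show "h \<in> rot r g ` signs_with \<Phi> X" by (auto simp: signs_with_def)
  next
    fix h assume "h \<in> rot r g ` signs_with \<Phi> X"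
    then obtain h' where h': "h' \<in> signs_with \<Phi> X" "h = rot r g h'" by auto
    then have "h' < r" using signs_with_subset[of X A r \<Phi>] assms by auto
    then show "h \<in> signs_with \<Phi> (apsnd (rot r g) ` X)" using h' cls by (simp add: signs_with_def)
  qed
qed

text \<open>Equivariant choice of a residue for a proper nonempty subset \<open>S\<close> of the integers mod \<open>p\<close>; it
  exists because \<open>card S\<close> is invertible.\<close>

definition mean_mod :: "nat \<Rightarrow> nat set \<Rightarrow> nat" where
  "mean_mod p S = (\<Sum>S * (SOME u. [card S * u = 1] (mod p))) mod p"

text \<open>Rotation by \<open>g\<close> adds \<open>card S * g\<close> to the sum modulo
  \<open>p\<close>, and the inverse of \<open>card S\<close> turns this into
  \<open>g\<close>.\<close>

lemma mean_mod_rot: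
  assumes "prime p" "S \<subset> {..<p}" "S \<noteq> {}"
  shows "mean_mod p (rot p g ` S) = rot p g (mean_mod p S)"
proof -
  have inj: "inj_on (rot p g) S" using assms(2) inj_on_rot inj_on_subset by blast
  have fin: "finite S" using assms(2) finite_subset by blast
  have "card S < p" using psubset_card_mono[OF _ assms(2)] by simp
  moreover have "card S > 0" using assms fin by (simp add: card_gt_0_iff)
  ultimately have "coprime (card S) p"
    using assms(1) by (metis coprime_commute nat_dvd_not_less prime_imp_coprime)
  then have "\<exists>u. [card S * u = 1] (mod p)" using cong_solve_coprime_nat by simp
  then have u: "[card S * (SOME u. [card S * u = 1] (mod p)) = 1] (mod p)" (is "[_ * ?u = 1] (mod p)")
    by (rule someI_ex)
  have "[\<Sum>(rot p g ` S) = (\<Sum>a\<in>S. a + g)] (mod p)"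
    unfolding sum.reindex[OF inj] by (auto intro!: cong_sum simp: rot_def)
  also have "(\<Sum>a\<in>S. a + g) = \<Sum>S + card S * g" by (simp add: sum.distrib)
  finally have "[\<Sum>(rot p g ` S) * ?u = (\<Sum>S + card S * g) * ?u] (mod p)"
    by (rule cong_scalar_right)
  also have "(\<Sum>S + card S * g) * ?u = \<Sum>S * ?u + card S * ?u * g" by (simp add: algebra_simps)
  also have "[\<Sum>S * ?u + card S * ?u * g = \<Sum>S * ?u + 1 * g] (mod p)"
    by (intro cong_add cong_refl cong_scalar_right u)
  finally show ?thesis
    unfolding mean_mod_def rot_def card_image[OF inj, unfolded rot_def[abs_def]]
    by (simp add: cong_def mod_simps rot_def[abs_def])
qed

lemma mean_mod_less: "p > 0 \<Longrightarrow> mean_mod p S < p"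
  by (simp add: mean_mod_def)

text \<open>Supplies the alternative for labels: either the rank grows, or all sets from which the
  label is chosen stay the same.\<close>

lemma sum_card_mono_cases:
  assumes "finite I" "\<And>i. i \<in> I \<Longrightarrow> S i \<subseteq> T i" "\<And>i. i \<in> I \<Longrightarrow> finite (T i)"
  shows "(\<Sum>i\<in>I. card (S i)) < (\<Sum>i\<in>I. card (T i)) \<or> (\<forall>i\<in>I. S i = T i)"
proof (cases "\<forall>i\<in>I. S i = T i")
  case False
  then obtain j where j: "j \<in> I" "S j \<noteq> T j" by blast
  then have "card (S j) < card (T j)" using assms by (meson psubset_card_mono psubsetI)
  moreover have "\<forall>i\<in>I. card (S i) \<le> card (T i)" using assms by (simp add: card_mono)
  ultimately have "(\<Sum>i\<in>I. card (S i)) < (\<Sum>i\<in>I. card (T i))"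
    using assms(1) j(1) by (intro sum_strict_mono_ex1) auto
  then show ?thesis ..
qed simp

section \<open>Monochromatic disjoint families for a prime number of sets\<close>

definition transversal :: "('a \<Rightarrow> nat) \<Rightarrow> 'a set \<Rightarrow> nat \<Rightarrow> 'a set \<Rightarrow> bool" where
  "transversal blk A k \<sigma> \<longleftrightarrow> \<sigma> \<subseteq> A \<and> card \<sigma> = k \<and> inj_on blk \<sigma>"

text \<open>The blocks are the fibres of \<open>blk\<close>.\<close>

definition kneser_forcing :: "nat \<Rightarrow> bool" where
  "kneser_forcing r \<longleftrightarrow> (\<forall>(A :: nat set) blk k m c. finite A \<longrightarrow> k \<ge> 1 \<longrightarrow>
     (\<forall>b. card {a \<in> A. blk a = b} \<le> r) \<longrightarrow>
     (\<forall>\<sigma>. transversal blk A k \<sigma> \<longrightarrow> c \<sigma> \<in> {1..m}) \<longrightarrow>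
     card A > m * (r - 1) + r * (k - 1) \<longrightarrow>
     (\<exists>F i. card F = r \<and> disjoint F \<and> (\<forall>\<sigma>\<in>F. transversal blk A k \<sigma> \<and> c \<sigma> = (i :: nat))))"

lemma kneser_forcing_1: "kneser_forcing 1"
  unfolding kneser_forcing_def
proof (intro allI impI)
  fix A :: "nat set" and blk :: "nat \<Rightarrow> nat" and k m and c :: "nat set \<Rightarrow> nat"
  assume A: "finite A" "card A > m * (1 - 1) + 1 * (k - 1)" and "k \<ge> 1"
    and b: "\<forall>b. card {a \<in> A. blk a = b} \<le> 1"
  then have "k \<le> card A" by simp
  then obtain \<sigma> where s: "\<sigma> \<subseteq> A" "card \<sigma> = k" using obtain_subset_with_card_n by blast
  have "inj_on blk A"
  proof (rule inj_onI)
    fix x y assume xy: "x \<in> A" "y \<in> A" "blk x = blk y"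
    then have "card {x, y} \<le> card {a \<in> A. blk a = blk x}" using A by (intro card_mono) auto
    then show "x = y" using b[rule_format, of "blk x"] by (cases "x = y") auto
  qed
  then have "transversal blk A k \<sigma>" using s by (auto simp: transversal_def intro: inj_on_subset)
  then show "\<exists>F i. card F = 1 \<and> disjoint F \<and> (\<forall>\<sigma>\<in>F. transversal blk A k \<sigma> \<and> c \<sigma> = i)"
    by (intro exI[of _ "{\<sigma>}"]) auto
qed

lemma ex_transversal:
  assumes "finite B" "k \<le> card B" "\<And>b. b \<in> B \<Longrightarrow> \<exists>a\<in>C. blk a = b"
  shows "\<exists>\<sigma>\<subseteq>C. card \<sigma> = k \<and> inj_on blk \<sigma>"
proof -
  obtain B' where B': "B' \<subseteq> B" "card B' = k" using obtain_subset_with_card_n assms(2) by blast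
  obtain h where h: "\<And>b. b \<in> B \<Longrightarrow> h b \<in> C \<and> blk (h b) = b" using assms(3) by metis
  have "inj_on h B'" using h B'(1) by (metis inj_onI subsetD)
  then have "card (h ` B') = k" using B' by (simp add: card_image)
  moreover have "inj_on blk (h ` B')" using h B'(1) by (auto simp: inj_on_def) (metis subsetD)+
  moreover have "h ` B' \<subseteq> C" using h B'(1) by auto
  ultimately show ?thesis by blast
qed

lemma kneser_forcing_prime:
  assumes p: "prime p"
  shows "kneser_forcing p"
  unfolding kneser_forcing_def
proof (intro allI impI, rule ccontr)
  fix A :: "nat set" and blk :: "nat \<Rightarrow> nat" and k m and c :: "nat set \<Rightarrow> nat"
  assume finA: "finite A" and big: "card A > m * (p - 1) + p * (k - 1)" and k: "k \<ge> 1"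
    and fibre: "\<forall>b. card {a \<in> A. blk a = b} \<le> p"
    and col: "\<forall>\<sigma>. transversal blk A k \<sigma> \<longrightarrow> c \<sigma> \<in> {1..m}"
    and no: "\<not> (\<exists>F i. card F = p \<and> disjoint F \<and> (\<forall>\<sigma>\<in>F. transversal blk A k \<sigma> \<and> c \<sigma> = i))"
  define meets where "meets b C \<longleftrightarrow> (\<exists>a\<in>C. blk a = b)" for b and C :: "nat set"
  define hascol where "hascol i C \<longleftrightarrow> (\<exists>\<sigma>\<subseteq>C. card \<sigma> = k \<and> inj_on blk \<sigma> \<and> c \<sigma> = i)" for i C
  define sg where "sg X b = signs_with (meets b) X" for X b
  define gc where "gc X i = signs_with (hascol i) X" for X i
  define \<nu> where "\<nu> X = (\<Sum>b\<in>blk ` A. card (sg X b))" for X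
  define small where "small X \<longleftrightarrow> \<nu> X \<le> p * (k - 1)" for X
  define \<rho> where "\<rho> X = (if small X then \<nu> X else p * (k - 1) + (\<Sum>i\<in>{1..m}. card (gc X i)))" for X
  \<comment> \<open>\<open>bl\<close> and \<open>co\<close> depend on \<open>X\<close> only through
    which of its sign sets are empty. Hence they are invariant under shifts and agree for vectors
    with equal sign sets.\<close>
  define bl where "bl X = (SOME b. b \<in> blk ` A \<and> sg X b \<noteq> {})" for X
  define co where "co X = (SOME i. i \<in> {1..m} \<and> gc X i \<noteq> {})" for X
  define rep where "rep b = (SOME a. a \<in> A \<and> blk a = b)" for b
  \<comment> \<open>\<open>mean_mod\<close> is equivariant only on proper nonempty subsets. If the
    block \<open>bl X\<close> shows all signs, the sign of \<open>rep (bl X)\<close> takes over, an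
    element that depends on the block alone.\<close>
  define lab where "lab X = (if \<not> small X then mean_mod p (gc X (co X))
      else if sg X (bl X) = {..<p} then THE g. (rep (bl X), g) \<in> X
      else mean_mod p (sg X (bl X)))" for X
  define valid where "valid X \<longleftrightarrow> X \<subseteq> A \<times> {..<p} \<and> single_valued X \<and> X \<noteq> {}" for X
  have p0: "p \<ge> 2" using p by (simp add: prime_ge_2_nat)
  have nm: "\<not> meets b {}" "\<not> hascol i {}" for b i using k by (auto simp: meets_def hascol_def)
  have mono: "mono (meets b)" "mono (hascol i)" for b i
    by (auto simp: mono_def meets_def hascol_def)
  have sub: "sg X b \<subseteq> {..<p}" "gc X i \<subseteq> {..<p}" if "valid X" for X b i
    using that signs_with_subset[of X A p "meets b"] signs_with_subset[of X A p "hascol i"] nm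
    unfolding sg_def gc_def valid_def by auto
  have fin: "finite (sg X b)" "finite (gc X i)" if "valid X" for X b i
    by (rule finite_subset[OF sub(1)[OF that]], simp, rule finite_subset[OF sub(2)[OF that]], simp)
  have smono: "sg Y b \<subseteq> sg X b" "gc Y i \<subseteq> gc X i" if "Y \<subseteq> X" for X Y b i
    unfolding sg_def gc_def by (rule signs_with_mono[OF that mono(1)], rule signs_with_mono[OF that mono(2)])
  have sh: "sg (apsnd (rot p g) ` X) b = rot p g ` sg X b"
    "gc (apsnd (rot p g) ` X) i = rot p g ` gc X i" if "valid X" for X g b i
    using that signs_with_shift[of X A p "meets b" g] signs_with_shift[of X A p "hascol i" g] nm
    unfolding sg_def gc_def valid_def by auto
  have disj: "{a. (a, g) \<in> X} \<inter> {a. (a, h) \<in> X} = {}" if "valid X" "g \<noteq> h" for X g h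
    using that unfolding valid_def by (auto dest: single_valuedD)

  have bl: "bl X \<in> blk ` A \<and> sg X (bl X) \<noteq> {}" if X: "valid X" for X
  proof -
    obtain a g where "(a, g) \<in> X" using X unfolding valid_def by auto
    then have "blk a \<in> blk ` A \<and> sg X (blk a) \<noteq> {}"
      using X unfolding valid_def sg_def signs_with_def meets_def by auto
    then show ?thesis unfolding bl_def by (rule someI)
  qed
  have co: "co X \<in> {1..m} \<and> gc X (co X) \<noteq> {}" if X: "valid X" "\<not> small X" for X
  proof -
    \<comment> \<open>Double counting of pairs of a block and a sign occurring in it: a total above
      \<open>p * (k - 1)\<close> forces some sign to meet at least \<open>k\<close> blocks.\<close>
    have "\<nu> X = (\<Sum>b\<in>blk ` A. \<Sum>g<p. of_bool (g \<in> sg X b))"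
      unfolding \<nu>_def using sub(1)[OF X(1)] by (simp add: Int_absorb1)
    also have "\<dots> = (\<Sum>g<p. \<Sum>b\<in>blk ` A. of_bool (g \<in> sg X b))" by (rule sum.swap)
    also have "\<dots> = (\<Sum>g<p. card {b \<in> blk ` A. g \<in> sg X b})"
      using finA by (simp add: Int_def conj_commute)
    finally have gt: "(\<Sum>g<p. card {b \<in> blk ` A. g \<in> sg X b}) > p * (k - 1)"
      using X(2) unfolding small_def by simp
    have "\<not> (\<forall>g<p. card {b \<in> blk ` A. g \<in> sg X b} \<le> k - 1)"
    proof
      assume "\<forall>g<p. card {b \<in> blk ` A. g \<in> sg X b} \<le> k - 1"
      then have "(\<Sum>g<p. card {b \<in> blk ` A. g \<in> sg X b}) \<le> (\<Sum>g<p. k - 1)"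
        by (intro sum_mono) auto
      also have "\<dots> = p * (k - 1)" by simp
      finally show False using gt by linarith
    qed
    then obtain g where "\<not> card {b \<in> blk ` A. g \<in> sg X b} \<le> k - 1" by blast
    then have g: "card {b \<in> blk ` A. g \<in> sg X b} \<ge> k" by linarith
    have "\<exists>\<sigma>\<subseteq>{a. (a, g) \<in> X}. card \<sigma> = k \<and> inj_on blk \<sigma>"
      by (rule ex_transversal[OF _ g]) (use finA in \<open>auto simp: sg_def signs_with_def meets_def\<close>)
    then obtain \<sigma> where s: "\<sigma> \<subseteq> {a. (a, g) \<in> X}" "card \<sigma> = k" "inj_on blk \<sigma>" by blast
    then have "transversal blk A k \<sigma>" using X(1) unfolding transversal_def valid_def by auto
    then have "c \<sigma> \<in> {1..m}" using col by blast
    moreover have "g \<in> gc X (c \<sigma>)" using s unfolding gc_def signs_with_def hascol_def by auto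
    ultimately have "c \<sigma> \<in> {1..m} \<and> gc X (c \<sigma>) \<noteq> {}" by blast
    then show ?thesis unfolding co_def by (rule someI)
  qed
  have gc_proper: "gc X i \<noteq> {..<p}" if X: "valid X" for X i
  proof
    assume "gc X i = {..<p}"
    then have "\<forall>g\<in>{..<p}. \<exists>\<sigma>\<subseteq>{a. (a, g) \<in> X}. card \<sigma> = k \<and> inj_on blk \<sigma> \<and> c \<sigma> = i"
      unfolding gc_def signs_with_def hascol_def by auto
    then obtain s where s: "\<And>g. g < p \<Longrightarrow> s g \<subseteq> {a. (a, g) \<in> X} \<and> card (s g) = k \<and> inj_on blk (s g) \<and> c (s g) = i"
      by (metis lessThan_iff)
    \<comment> \<open>As \<open>k >= 1\<close>, the disjoint sets are nonempty and hence distinct,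
      so they number exactly \<open>p\<close>.\<close>
    have ne: "s g \<noteq> {}" if "g < p" for g using s[OF that] k by auto
    have dj: "s g \<inter> s h = {}" if "g < p" "h < p" "g \<noteq> h" for g h
      using s that disj[OF X that(3)] by blast
    have "inj_on s {..<p}" using ne dj by (intro inj_onI) (metis inf.idem lessThan_iff)
    then have "card (s ` {..<p}) = p" by (simp add: card_image)
    moreover have "disjoint (s ` {..<p})" using dj unfolding disjoint_def by auto
    moreover have "\<forall>\<sigma>\<in>s ` {..<p}. transversal blk A k \<sigma> \<and> c \<sigma> = i"
      using s X unfolding transversal_def valid_def by blast
    ultimately show False using no by blast
  qed
  have rep: "\<exists>!g. (rep b, g) \<in> X" if X: "valid X" and b: "b \<in> blk ` A" "sg X b = {..<p}" for X b
  proof -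
    let ?D = "{a \<in> A. blk a = b \<and> a \<in> Domain X}"
    have sv: "single_valued X" using X unfolding valid_def by simp
    \<comment> \<open>Distinct signs sit on distinct elements, so \<open>p\<close> signs exhaust a
      block of at most \<open>p\<close> elements; in particular \<open>rep b\<close> carries a
      sign.\<close>
    have "{..<p} \<subseteq> (\<lambda>a. THE g. (a, g) \<in> X) ` ?D"
    proof
      fix g assume "g \<in> {..<p}"
      then obtain a where a: "(a, g) \<in> X" "blk a = b"
        using b unfolding sg_def signs_with_def meets_def by auto
      then have "(THE g. (a, g) \<in> X) = g" using sv by (auto dest: single_valuedD)
      moreover have "a \<in> ?D" using a X unfolding valid_def by auto
      ultimately show "g \<in> (\<lambda>a. THE g. (a, g) \<in> X) ` ?D" by force
    qed
    moreover have "finite ?D" using finA by simp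
    ultimately have "card {..<p} \<le> card ?D" by (rule surj_card_le[rotated])
    then have "p \<le> card ?D" by simp
    moreover have "card {a \<in> A. blk a = b} \<le> p" using fibre by blast
    ultimately have "?D = {a \<in> A. blk a = b}" using finA by (intro card_seteq) auto
    moreover have "rep b \<in> A \<and> blk (rep b) = b"
      unfolding rep_def by (rule someI_ex) (use b in auto)
    ultimately have "rep b \<in> Domain X" by blast
    then show ?thesis using sv by (auto dest: single_valuedD)
  qed

  have gc_pos: "0 < (\<Sum>i\<in>{1..m}. card (gc X i))" if X: "valid X" "\<not> small X" for X
  proof -
    have "0 < card (gc X (co X))" using co[OF X] fin[OF X(1)] by (simp add: card_gt_0_iff)
    also have "\<dots> \<le> (\<Sum>i\<in>{1..m}. card (gc X i))"
      using co[OF X] by (intro member_le_sum) auto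
    finally show ?thesis .
  qed
  have bounds: "1 \<le> \<rho> X \<and> \<rho> X \<le> m * (p - 1) + p * (k - 1)" if X: "valid X" for X
  proof (cases "small X")
    case True
    have "0 < card (sg X (bl X))" using bl[OF X] fin[OF X] by (simp add: card_gt_0_iff)
    also have "\<dots> \<le> \<nu> X" unfolding \<nu>_def using bl[OF X] finA by (intro member_le_sum) auto
    finally show ?thesis using True unfolding \<rho>_def small_def by simp
  next
    case False
    have "(\<Sum>i\<in>{1..m}. card (gc X i)) \<le> (\<Sum>i\<in>{1..m}. p - 1)"
    proof (rule sum_mono)
      fix i
      have "gc X i \<subset> {..<p}" using gc_proper[OF X] sub[OF X] by blast
      then have "card (gc X i) < p" using psubset_card_mono[of "{..<p}" "gc X i"] by simp
      then show "card (gc X i) \<le> p - 1" by simp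
    qed
    then show ?thesis using gc_pos[OF X False] False unfolding \<rho>_def by simp
  qed
  have rank: "\<rho> Y < \<rho> X \<or> lab Y = lab X" if X: "valid X" and Y: "valid Y" and YX: "Y \<subseteq> X" for X Y
  proof -
    have nu: "\<nu> Y < \<nu> X \<or> (\<forall>b\<in>blk ` A. sg Y b = sg X b)"
      unfolding \<nu>_def using finA smono[OF YX] fin[OF X] by (intro sum_card_mono_cases) auto
    have nule: "\<nu> Y \<le> \<nu> X"
      unfolding \<nu>_def using smono(1)[OF YX] fin(1)[OF X] by (intro sum_mono card_mono)
    consider "small X" "small Y" | "\<not> small X" "small Y" | "\<not> small X" "\<not> small Y"
      using nule unfolding small_def by linarith
    then show ?thesis
    proof cases
      case 1
      show ?thesis
      proof (cases "\<nu> Y < \<nu> X")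
        case False
        with nu have eq: "sg Y b = sg X b" if "b \<in> blk ` A" for b using that by blast
        then have "(\<lambda>b. b \<in> blk ` A \<and> sg Y b \<noteq> {}) = (\<lambda>b. b \<in> blk ` A \<and> sg X b \<noteq> {})" by auto
        then have "bl Y = bl X" unfolding bl_def by (simp only:)
        moreover have "(THE g. (rep (bl X), g) \<in> Y) = (THE g. (rep (bl X), g) \<in> X)"
          if "sg X (bl X) = {..<p}"
        proof -
          have "bl X \<in> blk ` A" using bl[OF X] by blast
          then have "\<exists>!g. (rep (bl X), g) \<in> Y" "\<exists>!g. (rep (bl X), g) \<in> X"
            using rep[OF X, of "bl X"] rep[OF Y, of "bl X"] eq that by auto
          then show ?thesis using YX by (metis subsetD the1_equality)
        qed
        ultimately show ?thesis using 1 eq bl[OF X] unfolding lab_def by simp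
      qed (use 1 in \<open>simp add: \<rho>_def\<close>)
    next
      case 2
      \<comment> \<open>Beyond the threshold some colour occurs, which lifts the rank of
        \<open>X\<close> strictly above the bound that \<open>\<nu> Y\<close> obeys.\<close>
      have "\<rho> X > p * (k - 1)" using gc_pos[OF X 2(1)] 2(1) unfolding \<rho>_def by simp
      then show ?thesis using 2 unfolding \<rho>_def small_def by simp
    next
      case 3
      have "(\<Sum>i\<in>{1..m}. card (gc Y i)) < (\<Sum>i\<in>{1..m}. card (gc X i)) \<or> (\<forall>i\<in>{1..m}. gc Y i = gc X i)"
        using smono[OF YX] fin[OF X] by (intro sum_card_mono_cases) auto
      then show ?thesis
      proof
        assume eq: "\<forall>i\<in>{1..m}. gc Y i = gc X i"
        then have "(\<lambda>i. i \<in> {1..m} \<and> gc Y i \<noteq> {}) = (\<lambda>i. i \<in> {1..m} \<and> gc X i \<noteq> {})" by auto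
        then have "co Y = co X" unfolding co_def by (simp only:)
        then show ?thesis using 3 eq co[OF X 3(1)] unfolding lab_def by simp
      qed (use 3 in \<open>simp add: \<rho>_def\<close>)
    qed
  qed
  have lab_less: "lab X < p" if X: "valid X" for X
  proof -
    have "(THE g. (rep (bl X), g) \<in> X) < p" if "sg X (bl X) = {..<p}"
      using theI'[OF rep[OF X _ that]] bl[OF X] X unfolding valid_def by auto
    then show ?thesis using mean_mod_less p0 unfolding lab_def by auto
  qed
  have lab_shift: "lab (apsnd (rot p g) ` X) = rot p g (lab X)" if X: "valid X" for X g
  proof -
    let ?X = "apsnd (rot p g) ` X"
    have cards: "card (rot p g ` S) = card S" if "S \<subseteq> {..<p}" for S
      using that inj_on_rot inj_on_subset by (metis card_image)
    have nu: "\<nu> ?X = \<nu> X" unfolding \<nu>_def using sh[OF X] cards sub[OF X] by simp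
    then have small: "small ?X = small X" unfolding small_def by simp
    have bl': "bl ?X = bl X" unfolding bl_def using sh[OF X] by simp
    have co': "co ?X = co X" unfolding co_def using sh[OF X] by simp
    have full: "sg ?X b = {..<p} \<longleftrightarrow> sg X b = {..<p}" for b
    proof -
      have "card (sg ?X b) = card (sg X b)" using sh[OF X] cards sub[OF X] by simp
      moreover have "sg ?X b \<subseteq> {..<p}" using sh[OF X] p0 by (auto simp: rot_less)
      ultimately show ?thesis using sub[OF X] by (metis card_subset_eq finite_lessThan)
    qed
    have the: "(THE h. (rep (bl X), h) \<in> ?X) = rot p g (THE h. (rep (bl X), h) \<in> X)"
      if f: "sg X (bl X) = {..<p}"
    proof -
      have ex1: "\<exists>!h. (rep (bl X), h) \<in> X" using rep[OF X _ f] bl[OF X] by blast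
      show ?thesis
      proof (rule the_equality)
        have "apsnd (rot p g) (rep (bl X), THE h. (rep (bl X), h) \<in> X) \<in> ?X"
          using theI'[OF ex1] by (rule imageI)
        then show "(rep (bl X), rot p g (THE h. (rep (bl X), h) \<in> X)) \<in> ?X" by simp
      next
        fix h assume "(rep (bl X), h) \<in> ?X"
        then obtain h' where "(rep (bl X), h') \<in> X" "h = rot p g h'" by auto
        then show "h = rot p g (THE h. (rep (bl X), h) \<in> X)" using the1_equality[OF ex1] by simp
      qed
    qed
    have m1: "mean_mod p (gc ?X (co X)) = rot p g (mean_mod p (gc X (co X)))" if "\<not> small X"
      using sh[OF X] co[OF X that] gc_proper[OF X] sub[OF X] by (simp add: mean_mod_rot[OF p] psubsetI)
    have m2: "mean_mod p (sg ?X (bl X)) = rot p g (mean_mod p (sg X (bl X)))" if "sg X (bl X) \<noteq> {..<p}"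
      using sh[OF X] bl[OF X] that sub[OF X] by (simp add: mean_mod_rot[OF p] psubsetI)
    show ?thesis unfolding lab_def small bl' co' full using m1 m2 the by auto
  qed
  have val: "valid (set x)" if "sign_vector p A x" "x \<noteq> []" for x
    using that unfolding valid_def sign_vector_def single_valued_def
    by (auto dest: eq_key_imp_eq_value)
  interpret equivariant_labelling p A "\<lambda>x. lab (set x)"
    by unfold_locales (use p0 val lab_less lab_shift in \<open>auto simp: shift_def\<close>)
  have "card A \<le> m * (p - 1) + p * (k - 1)"
  proof (rule card_le_rank[where \<rho> = "\<lambda>x. \<rho> (set x)"])
    fix x y assume "sign_vector p A x" "sign_vector p A y" "y \<noteq> []" "set y \<subseteq> set x"
    moreover from this have "x \<noteq> []" by auto
    ultimately show "\<rho> (set y) < \<rho> (set x) \<or> lab (set y) = lab (set x)"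
      by (intro rank val)
  qed (use finA bounds val in auto)
  then show False using big by simp
qed

section \<open>Multiplicativity and the general case\<close>

text \<open>Colour each transversal \<open>N\<close>-set of a refined partition (into blocks of size at most \<open>r\<close>) by the
  colour of a monochromatic family of \<open>s\<close> disjoint sets inside it, then apply the case \<open>r\<close>.\<close>

lemma kneser_forcing_mult:
  assumes r: "kneser_forcing r" and s: "kneser_forcing s" and pos: "r \<ge> 1" "s \<ge> 1"
  shows "kneser_forcing (r * s)"
  unfolding kneser_forcing_def
proof (intro allI impI)
  fix A :: "nat set" and blk :: "nat \<Rightarrow> nat" and k m and c :: "nat set \<Rightarrow> nat"
  assume finA: "finite A" and big: "card A > m * (r * s - 1) + r * s * (k - 1)" and k: "k \<ge> 1"
    and fibre: "\<forall>b. card {a \<in> A. blk a = b} \<le> r * s"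
    and col: "\<forall>\<sigma>. transversal blk A k \<sigma> \<longrightarrow> c \<sigma> \<in> {1..m}"
  \<comment> \<open>\<open>idx\<close> numbers the elements of each block from 0, and
    \<open>idx a div r\<close> cuts the block into at most \<open>s\<close> pieces of at most
    \<open>r\<close> elements.\<close>
  define idx where "idx a = card {a' \<in> A. blk a' = blk a \<and> a' < a}" for a
  define blk' where "blk' a = prod_encode (blk a, idx a div r)" for a
  \<comment> \<open>The least cardinality to which \<open>kneser_forcing s\<close> applies with
    \<open>m\<close> colours.\<close>
  define N where "N = m * (s - 1) + s * (k - 1) + 1"
  have idx_mono: "idx a < idx b" if "a \<in> A" "blk a = blk b" "a < b" for a b
    unfolding idx_def using finA that by (intro psubset_card_mono) auto
  have idx_inj: "a = b" if "a \<in> A" "b \<in> A" "blk a = blk b" "idx a = idx b" for a b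
    using idx_mono[of a b] idx_mono[of b a] that by (metis less_irrefl not_less_iff_gr_or_eq)
  have idx_less: "idx a < r * s" if "a \<in> A" for a
  proof -
    have "idx a < card {a' \<in> A. blk a' = blk a}"
      unfolding idx_def using finA that by (intro psubset_card_mono) auto
    then show ?thesis using fibre by (meson order_less_le_trans)
  qed
  have fibre': "card {a \<in> A. blk' a = b} \<le> r" for b
  proof -
    obtain b1 b2 where b: "b = prod_encode (b1, b2)" by (metis prod_decode_inverse surj_pair)
    have "idx ` {a \<in> A. blk' a = b} \<subseteq> {b2 * r..<b2 * r + r}"
    proof
      fix i assume "i \<in> idx ` {a \<in> A. blk' a = b}"
      then have "i div r = b2" by (auto simp: blk'_def b)
      then have "i = b2 * r + i mod r" by (metis div_mult_mod_eq)
      moreover have "i mod r < r" using pos by simp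
      ultimately show "i \<in> {b2 * r..<b2 * r + r}" by (metis atLeastLessThan_iff le_add1 nat_add_left_cancel_less)
    qed
    then have "card (idx ` {a \<in> A. blk' a = b}) \<le> r"
      by (metis add_diff_cancel_left' card_atLeastLessThan card_mono finite_atLeastLessThan)
    moreover have "inj_on idx {a \<in> A. blk' a = b}"
      using idx_inj by (auto simp: inj_on_def blk'_def b)
    ultimately show ?thesis by (simp add: card_image)
  qed
  have inner: "\<exists>F i. i \<in> {1..m} \<and> card F = s \<and> disjoint F \<and> (\<forall>\<sigma>\<in>F. transversal blk B k \<sigma> \<and> c \<sigma> = i)"
    if B: "transversal blk' A N B" for B
  proof -
    have BA: "B \<subseteq> A" and cB: "card B = N" and inj: "inj_on blk' B"
      using B by (auto simp: transversal_def)
    \<comment> \<open>\<open>B\<close> takes at most one element from each of the at most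
      \<open>s\<close> pieces of a block.\<close>
    have "card {a \<in> B. blk a = b} \<le> s" for b
    proof -
      have "inj_on (\<lambda>a. idx a div r) {a \<in> B. blk a = b}"
        using inj by (auto simp: inj_on_def blk'_def)
      moreover have "(\<lambda>a. idx a div r) ` {a \<in> B. blk a = b} \<subseteq> {..<s}"
        using idx_less BA by (auto simp: less_mult_imp_div_less mult.commute)
      ultimately show ?thesis by (metis card_inj_on_le card_lessThan finite_lessThan)
    qed
    moreover have tr: "transversal blk A k \<sigma>" if "transversal blk B k \<sigma>" for \<sigma>
      using that BA by (auto simp: transversal_def)
    moreover have "finite B" using BA finA finite_subset by blast
    moreover have "card B > m * (s - 1) + s * (k - 1)" using cB N_def by simp
    ultimately obtain F i where F: "card F = s" "disjoint F"
      "\<forall>\<sigma>\<in>F. transversal blk B k \<sigma> \<and> c \<sigma> = i"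
      using s[unfolded kneser_forcing_def, rule_format, of B k blk c m] k col by blast
    then obtain \<sigma> where "\<sigma> \<in> F" using pos by (metis card.empty equals0I not_one_le_zero)
    then have "transversal blk A k \<sigma>" "c \<sigma> = i" using F(3) tr by simp_all
    then have "i \<in> {1..m}" using col[rule_format, of \<sigma>] by simp
    then show ?thesis using F by blast
  qed
  then obtain fam c' where fam: "\<And>B. transversal blk' A N B \<Longrightarrow> c' B \<in> {1..m} \<and> card (fam B) = s \<and>
      disjoint (fam B) \<and> (\<forall>\<sigma>\<in>fam B. transversal blk B k \<sigma> \<and> c \<sigma> = c' B)"
    by metis
  \<comment> \<open>The choice of \<open>N\<close> makes the thresholds for \<open>s\<close> and
    \<open>r\<close> compose exactly.\<close>
  have "m * (r * s - 1) + r * s * (k - 1) = m * (r - 1) + r * (N - 1)"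
  proof -
    obtain r' s' k' where "r = Suc r'" "s = Suc s'" "k = Suc k'"
      using pos k by (metis Suc_le_D One_nat_def)
    then show ?thesis by (simp add: N_def algebra_simps)
  qed
  then have "card A > m * (r - 1) + r * (N - 1)" using big by simp
  moreover have "N \<ge> 1" by (simp add: N_def)
  ultimately obtain G i where G: "card G = r" "disjoint G"
    "\<forall>B\<in>G. transversal blk' A N B \<and> c' B = i"
    using r[unfolded kneser_forcing_def, rule_format, of A N blk' c' m] finA fibre' fam by blast
  have GA: "B \<subseteq> A" and card_fam: "card (fam B) = s" and disj_fam: "disjoint (fam B)" if "B \<in> G" for B
    using G(3) fam[of B] that by (simp_all add: transversal_def)
  have fam_tr: "transversal blk B k \<sigma>" "c \<sigma> = i" if "B \<in> G" "\<sigma> \<in> fam B" for B \<sigma>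
    using G(3) fam[of B] that by simp_all
  have sub: "\<sigma> \<subseteq> B" "\<sigma> \<noteq> {}" if "B \<in> G" "\<sigma> \<in> fam B" for B \<sigma>
    using fam_tr(1)[OF that] k unfolding transversal_def by auto
  have "finite G" using G(1) pos by (metis card.infinite not_one_le_zero)
  moreover have "finite (fam B)" if "B \<in> G" for B
    using card_fam[OF that] pos by (metis card.infinite not_one_le_zero)
  moreover have "fam B \<inter> fam B' = {}" if "B \<in> G" "B' \<in> G" "B \<noteq> B'" for B B'
  proof (rule equals0I)
    fix \<sigma> assume "\<sigma> \<in> fam B \<inter> fam B'"
    then have "\<sigma> \<subseteq> B" "\<sigma> \<subseteq> B'" "\<sigma> \<noteq> {}" using sub that(1,2) by simp_all
    then show False using disjointD[OF G(2) that] by blast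
  qed
  ultimately have "card (\<Union>B\<in>G. fam B) = (\<Sum>B\<in>G. card (fam B))"
    by (intro card_UN_disjoint) auto
  also have "\<dots> = r * s" using card_fam G(1) by simp
  finally have "card (\<Union>B\<in>G. fam B) = r * s" .
  moreover have "disjoint (\<Union>B\<in>G. fam B)"
  proof (rule disjointI)
    fix \<sigma> \<tau> assume "\<sigma> \<in> (\<Union>B\<in>G. fam B)" "\<tau> \<in> (\<Union>B\<in>G. fam B)" and ne: "\<sigma> \<noteq> \<tau>"
    then obtain B B' where B: "B \<in> G" "\<sigma> \<in> fam B" "B' \<in> G" "\<tau> \<in> fam B'" by blast
    show "\<sigma> \<inter> \<tau> = {}"
    proof (cases "B = B'")
      case True
      then show ?thesis using disjointD[OF disj_fam[OF B(1)] B(2), of \<tau>] B(4) ne by simp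
    next
      case False
      then show ?thesis using sub(1)[OF B(1,2)] sub(1)[OF B(3,4)] disjointD[OF G(2) B(1,3)] by blast
    qed
  qed
  moreover have "\<forall>\<sigma>\<in>\<Union>B\<in>G. fam B. transversal blk A k \<sigma> \<and> c \<sigma> = i"
  proof
    fix \<sigma> assume "\<sigma> \<in> (\<Union>B\<in>G. fam B)"
    then obtain B where B: "B \<in> G" "\<sigma> \<in> fam B" by blast
    show "transversal blk A k \<sigma> \<and> c \<sigma> = i"
      using fam_tr[OF B] GA[OF B(1)] unfolding transversal_def by blast
  qed
  ultimately show "\<exists>F i. card F = r * s \<and> disjoint F \<and> (\<forall>\<sigma>\<in>F. transversal blk A k \<sigma> \<and> c \<sigma> = i)"
    by blast
qed

lemma kneser_forcing_all: "r \<ge> 1 \<Longrightarrow> kneser_forcing r"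
proof (induction r rule: prime_divisors_induct)
  case (factor p r)
  show ?case
  proof (cases "r = 0")
    case False
    then show ?thesis using factor kneser_forcing_mult[of p r] kneser_forcing_prime[of p]
      by (simp add: prime_gt_0_nat Suc_leI)
  qed (use factor in simp)
qed (use kneser_forcing_1 in auto)

section \<open>The two bounds for the chromatic number\<close>

lemma kneser_b_le:
  assumes "r \<ge> 1"
  shows "kneser_b r \<le> r"
proof -
  have "kneser_b r \<le> (\<Prod>p\<in>prime_factors r. p ^ multiplicity p r)"
    unfolding kneser_b_def by (intro prod_mono) (auto intro: power_mono)
  also have "\<dots> = r" using assms prod_prime_factors[of r] by simp
  finally show ?thesis .
qed

lemma KG_lower_bound:
  assumes r: "r \<ge> 2" and k: "k \<ge> 1" and P: "partition_on {1..n} P"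
    and B: "\<forall>B\<in>P. card B \<le> r" and c: "hg_coloring (KG r n k P) m c"
  shows "n \<le> m * (r - 1) + r * (k - 1)"
proof (rule ccontr)
  assume "\<not> ?thesis"
  then have big: "card {1..n} > m * (r - 1) + r * (k - 1)" by simp
  have "finite P" using P by (metis finite_UnionD finite_atLeastAtMost partition_onD1)
  \<comment> \<open>\<open>kneser_forcing\<close> names blocks by numbers, so the finite partition
    is injected into the naturals.\<close>
  then obtain f :: "nat set \<Rightarrow> nat" where f: "inj_on f P"
    using finite_imp_inj_to_nat_seg by blast
  define bl where "bl a = (THE B. B \<in> P \<and> a \<in> B)" for a
  have bl: "bl a = B" if "B \<in> P" "a \<in> B" for a B
    unfolding bl_def
    by (rule the_equality) (use that P in \<open>auto simp: partition_on_def disjoint_def\<close>)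
  have ex: "\<exists>B\<in>P. a \<in> B" if "a \<in> {1..n}" for a
    using that partition_onD1[OF P] by blast
  define blk where "blk a = f (bl a)" for a
  have blk: "blk a = blk b \<longleftrightarrow> B = B'" if "B \<in> P" "a \<in> B" "B' \<in> P" "b \<in> B'" for a b B B'
    using that bl f by (auto simp: blk_def inj_on_def)
  have fibre: "card {a \<in> {1..n}. blk a = b} \<le> r" for b
  proof (cases "{a \<in> {1..n}. blk a = b} = {}")
    case False
    then obtain a where a: "a \<in> {1..n}" "blk a = b" by blast
    then obtain C where C: "C \<in> P" "a \<in> C" using ex by blast
    have "{a \<in> {1..n}. blk a = b} \<subseteq> C"
    proof
      fix x assume x: "x \<in> {a \<in> {1..n}. blk a = b}"
      then obtain C' where "C' \<in> P" "x \<in> C'" using ex by blast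
      then show "x \<in> C" using x a blk[OF C, of C' x] by auto
    qed
    moreover have "finite C" using C P by (metis Sup_upper finite_atLeastAtMost finite_subset partition_onD1)
    ultimately show ?thesis using B C card_mono le_trans by metis
  qed (simp only: card.empty)
  have tr: "\<sigma> \<in> KG_vertices n k P" if t: "transversal blk {1..n} k \<sigma>" for \<sigma>
  proof -
    have "card (\<sigma> \<inter> C) \<le> 1" if "C \<in> P" for C
    proof (rule card_le_Suc0_iff_eq[THEN iffD2, unfolded One_nat_def[symmetric]])
      show "finite (\<sigma> \<inter> C)" using t finite_subset by (auto simp: transversal_def)
      show "\<forall>x\<in>\<sigma> \<inter> C. \<forall>y\<in>\<sigma> \<inter> C. x = y"
        using t blk that by (auto simp: transversal_def inj_on_def)
    qed
    then show ?thesis using t by (auto simp: transversal_def KG_vertices_def)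
  qed
  have "c \<sigma> \<in> {1..m}" if "transversal blk {1..n} k \<sigma>" for \<sigma>
    using c tr[OF that] by (auto simp: hg_coloring_def KG_def)
  then obtain F i where F: "card F = r" "disjoint F"
    "\<forall>\<sigma>\<in>F. transversal blk {1..n} k \<sigma> \<and> c \<sigma> = i"
    using kneser_forcing_all[of r, unfolded kneser_forcing_def, rule_format, of "{1..n}" k blk c m]
      r k fibre big by auto
  have FV: "F \<subseteq> KG_vertices n k P" using F tr by blast
  then have "mset_set F \<in> hyperedges (KG r n k P)" using F by (auto simp: KG_def)
  moreover have "monochromatic c (mset_set F)"
    using F finite_subset[OF FV finite_KG_vertices] by (auto simp: monochromatic_def)
  ultimately show False using c by (auto simp: hg_coloring_def)
qed

text \<open>Each colour below \<open>m\<close> covers a run of \<open>r - 1\<close> possible minima,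
  too few for \<open>r\<close> disjoint sets. Sets of colour \<open>m\<close> avoid the first
  \<open>(m - 1) * (r - 1)\<close> points, and fewer than \<open>r * k\<close> points
  remain.\<close>

lemma KG_upper_bound:
  assumes r: "r \<ge> 2" and k: "k \<ge> 1" and m: "m \<ge> 1" and n: "n \<le> m * (r - 1) + r * (k - 1)"
  shows "\<exists>c. hg_coloring (KG r n k P) m c"
proof -
  define q where "q \<sigma> = (Min \<sigma> - 1) div (r - 1)" for \<sigma> :: "nat set"
  define c where "c \<sigma> = min (q \<sigma> + 1) m" for \<sigma>
  have "\<not> monochromatic c (mset_set F)"
    if F: "F \<subseteq> KG_vertices n k P" "card F = r" "disjoint F" for F
  proof
    assume mc: "monochromatic c (mset_set F)"
    have finF: "finite F" using F finite_KG_vertices finite_subset by blast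
    then obtain i where i: "\<And>\<sigma>. \<sigma> \<in> F \<Longrightarrow> c \<sigma> = i" using mc by (auto simp: monochromatic_def)
    have V: "\<sigma> \<subseteq> {1..n}" "card \<sigma> = k" "finite \<sigma>" "\<sigma> \<noteq> {}" if "\<sigma> \<in> F" for \<sigma>
      using F that k finite_subset[of \<sigma> "{1..n}"] by (auto simp: KG_vertices_def)
    have Mn: "Min \<sigma> \<in> \<sigma>" if "\<sigma> \<in> F" for \<sigma> using V[OF that] by simp
    show False
    proof (cases "i < m")
      case True
      define z where "z = (i - 1) * (r - 1)"
      have "Min ` F \<subseteq> {z + 1..<z + 1 + (r - 1)}"
      proof
        fix x assume "x \<in> Min ` F"
        then obtain \<sigma> where s: "\<sigma> \<in> F" "x = Min \<sigma>" by blast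
        have "(x - 1) div (r - 1) = i - 1" using i[OF s(1)] s True by (auto simp: c_def q_def)
        then have "x - 1 = z + (x - 1) mod (r - 1)" unfolding z_def by (metis div_mult_mod_eq)
        moreover have "(x - 1) mod (r - 1) < r - 1" using r by simp
        moreover have "x \<ge> 1" using V[OF s(1)] Mn[OF s(1)] s by auto
        ultimately show "x \<in> {z + 1..<z + 1 + (r - 1)}"
          unfolding atLeastLessThan_iff by linarith
      qed
      then have "card (Min ` F) \<le> r - 1"
        by (metis add_diff_cancel_left' card_atLeastLessThan card_mono finite_atLeastLessThan)
      moreover have "inj_on Min F"
        using Mn disjointD[OF F(3)] by (metis IntI empty_iff inj_onI)
      ultimately show False using F r by (simp add: card_image)
    next
      case False
      define z where "z = (m - 1) * (r - 1)"
      have "\<Union>F \<subseteq> {z + 1..n}"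
      proof
        fix x assume "x \<in> \<Union>F"
        then obtain \<sigma> where s: "\<sigma> \<in> F" "x \<in> \<sigma>" by blast
        have "m - 1 \<le> (Min \<sigma> - 1) div (r - 1)" using i[OF s(1)] False by (auto simp: c_def q_def)
        then have "z \<le> Min \<sigma> - 1"
          unfolding z_def using r by (simp add: less_eq_div_iff_mult_less_eq)
        moreover have "Min \<sigma> \<le> x" using V[OF s(1)] s by simp
        moreover have "Min \<sigma> \<ge> 1" "x \<le> n" using V(1)[OF s(1)] Mn[OF s(1)] s(2) by auto
        ultimately show "x \<in> {z + 1..n}" unfolding atLeastAtMost_iff by linarith
      qed
      then have "card (\<Union>F) \<le> n - z"
        by (metis card_atLeastAtMost card_mono diff_Suc_Suc finite_atLeastAtMost Suc_eq_plus1)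
      moreover have "card (\<Union>F) = r * k"
        using card_Union_disjoint[of F] F(2,3) V by (simp add: disjoint_def pairwise_def disjnt_def)
      moreover have "n - z < r * k"
      proof -
        obtain m' k' r' where "m = Suc m'" "k = Suc k'" "r = Suc r'"
          using m k r by (metis Suc_le_D One_nat_def numeral_2_eq_2)
        then show ?thesis using n by (simp add: z_def algebra_simps)
      qed
      ultimately show False by simp
    qed
  qed
  then have "hg_coloring (KG r n k P) m c"
    using m by (auto simp: hg_coloring_def KG_def c_def)
  then show ?thesis by blast
qed

theorem theorem3p6:
  fixes r k n :: nat and P :: "nat set set"
  assumes "r \<ge> 2" and "k \<ge> 1" and "n \<ge> r * k"
    and "partition_on {1..n} P"
    and "\<forall>B\<in>P. card B \<le> kneser_b r"
  shows "int (chromatic_number (KG r n k P)) =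
         \<lceil>(real n - real r * (real k - 1)) / (real r - 1)\<rceil>"
proof -
  define \<chi> where "\<chi> = chromatic_number (KG r n k P)"
  have iff: "(real n - real r * (real k - 1)) / (real r - 1) \<le> real m \<longleftrightarrow>
      n \<le> m * (r - 1) + r * (k - 1)" for m
  proof -
    have "(real n - real r * (real k - 1)) / (real r - 1) \<le> real m \<longleftrightarrow>
        real n \<le> real m * (real r - 1) + real r * (real k - 1)"
      using assms(1) by (simp add: pos_divide_le_eq algebra_simps)
    also have "real m * (real r - 1) + real r * (real k - 1) = real (m * (r - 1) + r * (k - 1))"
      using assms(1,2) by (simp add: of_nat_diff)
    finally show ?thesis by (simp only: of_nat_le_iff)
  qed
  have "\<forall>B\<in>P. card B \<le> r" using assms(1,5) kneser_b_le[of r] by fastforce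
  moreover obtain c where "hg_coloring (KG r n k P) \<chi> c"
    unfolding \<chi>_def using KG_colorable assms(1) by blast
  ultimately have low: "n \<le> \<chi> * (r - 1) + r * (k - 1)"
    using KG_lower_bound assms by blast
  have rk: "r * (k - 1) < r * k" using assms by simp
  have up: "\<chi> \<le> m" if "n \<le> m * (r - 1) + r * (k - 1)" for m
  proof -
    \<comment> \<open>Here \<open>n >= r * k\<close> provides the positive number of colours that
      \<open>KG_upper_bound\<close> asks for.\<close>
    have "m \<noteq> 0" using rk that assms(3) by (metis add_0 leD le_trans mult_0)
    then have "\<exists>c. hg_coloring (KG r n k P) m c" using KG_upper_bound that assms(1,2) by simp
    then show ?thesis unfolding \<chi>_def chromatic_number_def by (rule Least_le)
  qed
  have "\<lceil>(real n - real r * (real k - 1)) / (real r - 1)\<rceil> = int \<chi>"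
  proof (rule ceiling_unique)
    show "(real n - real r * (real k - 1)) / (real r - 1) \<le> of_int (int \<chi>)"
      using low iff[of \<chi>] by simp
    show "of_int (int \<chi>) - 1 < (real n - real r * (real k - 1)) / (real r - 1)"
    proof (rule ccontr)
      assume neg: "\<not> ?thesis"
      \<comment> \<open>Positivity of the quotient gives \<open>\<chi> >= 1\<close>, so that
        \<open>\<chi> - 1\<close> is not truncated below.\<close>
      have "0 < (real n - real r * (real k - 1)) / (real r - 1)"
        using iff[of 0] rk assms(3) by (metis add_0 leD le_trans mult_0 not_le of_nat_0)
      with neg have "\<chi> \<ge> 1" by (cases \<chi>) auto
      with neg have "(real n - real r * (real k - 1)) / (real r - 1) \<le> real (\<chi> - 1)"
        by (simp add: of_nat_diff)
      then show False using iff[of "\<chi> - 1"] up[of "\<chi> - 1"] \<open>\<chi> \<ge> 1\<close> by simp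
    qed
  qed
  then show ?thesis unfolding \<chi>_def by simp
qed

end
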